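(* Let $A$ be an $n\times n$ consensus matrix whose communication graph has connectivity $k$, and let $\mathcal{K}$ be a family of subsets of $V=\{1,\dots,n\}$ containing all subsets of cardinality $k$. Then there exists a set $K\subseteq V$ with $|K|=k$ such that no input of $K$ is identifiable, i.e., every input $u_K:\mathbb{N}\to\mathbb{R}^k$ for the system $x(t+1)=Ax(t)+B_Ku_K(t)$ is unidentifiable.
   Context: $\mathbb{N}=\{0,1,2,\dots\}$. A consensus matrix is a real square matrix that is row stochastic (nonnegative entries, rows summing to one) and primitive. Its communication graph is the directed graph on $V=\{1,\dots,n\}$ with edge $(j,i)$ if and only if $A_{ij}\neq 0$; the neighbor set of $j$ is $N_j=\{i\in V:(i,j)\in E\}$. A vertex cutset is a set $S\subset V$ such that $V\setminus S$ can be partitioned into two nonempty sets $V_1,V_3$ with no edge from $V_3$ to $V_1$; the connectivity of the graph is the minimum number of vertices in a vertex cutset (in particular such a cutset exists). For $K=\{i_1,i_2,\dots\}\subseteq V$, $B_K=[e_{i_1}\ e_{i_2}\ \cdots]$ with $e_i$ the canonical basis vectors. For $j\in V$ with $N_j=\{n_1,\dots,n_p\}$, $C_j=[e_{n_1}\ \cdots\ e_{n_p}]^{\mathsf T}$, and $y_j(x_0,u_K,t)=C_jx(t)$ is the output of node $j$ at time $t$ for $x(t+1)=Ax(t)+B_Ku_K(t)$, $x(0)=x_0$. For nonempty $K_1\in\mathcal{K}$, an input $u_{K_1}$ is unidentifiable if there exist $K_2\in\mathcal{K}$ with $K_2\neq K_1$, an input $u_{K_2}$, $x_1,x_2\in\mathbb{R}^n$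 and $j\in V$ with $y_j(x_1,u_{K_1},t)=y_j(x_2,u_{K_2},t)$ for all $t\in\mathbb{N}$; it is identifiable otherwise. *)

theory Defs
  imports "Jordan_Normal_Form.Matrix" "Graph_Theory.Pair_Digraph"
begin

text \<open>
  Matrices and vectors are those of \<open>Jordan_Normal_Form\<close>, whose indices start at \<open>0\<close>:
  the node set \<open>{1, \<dots>, n}\<close> is represented by \<open>{0..<n}\<close>.
\<close>

definition row_stochastic :: "real mat \<Rightarrow> bool" where
  "row_stochastic A \<longleftrightarrow>
     (\<forall>i<dim_row A. (\<forall>j<dim_col A. 0 \<le> A $$ (i, j)) \<and> (\<Sum>j<dim_col A. A $$ (i, j)) = 1)"

definition primitive_mat :: "real mat \<Rightarrow> bool" where
  "primitive_mat A \<longleftrightarrow> square_mat A \<and>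
     (\<forall>i<dim_row A. \<forall>j<dim_col A. 0 \<le> A $$ (i, j)) \<and>
     (\<exists>m>0. \<forall>i<dim_row A. \<forall>j<dim_col A. 0 < (A ^\<^sub>m m) $$ (i, j))"

definition consensus_matrix :: "real mat \<Rightarrow> bool" where
  "consensus_matrix A \<longleftrightarrow> square_mat A \<and> row_stochastic A \<and> primitive_mat A"

text \<open>The arc \<open>(j, i)\<close> points in the direction of influence: node \<open>i\<close> uses the state of node \<open>j\<close>.\<close>

definition communication_graph :: "real mat \<Rightarrow> nat pair_pre_digraph" where
  "communication_graph A =
     \<lparr> pverts = {0..<dim_row A},
       parcs = {(j, i). j < dim_row A \<and> i < dim_row A \<and> A $$ (i, j) \<noteq> 0} \<rparr>"

definition neighbors :: "'a pair_pre_digraph \<Rightarrow> 'a \<Rightarrow> 'a set" where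
  "neighbors G j = {i \<in> pverts G. (i, j) \<in> parcs G}"

definition vertex_cutset :: "'a pair_pre_digraph \<Rightarrow> 'a set \<Rightarrow> bool" where
  "vertex_cutset G S \<longleftrightarrow> S \<subseteq> pverts G \<and>
     (\<exists>V1 V3. V1 \<noteq> {} \<and> V3 \<noteq> {} \<and> V1 \<inter> V3 = {} \<and> V1 \<union> V3 = pverts G - S \<and>
        (\<forall>u\<in>V3. \<forall>v\<in>V1. (u, v) \<notin> parcs G))"

text \<open>A relation rather than a function, since a graph need not have a vertex cutset at all.\<close>

definition has_connectivity :: "'a pair_pre_digraph \<Rightarrow> nat \<Rightarrow> bool" where
  "has_connectivity G k \<longleftrightarrow>
     (\<exists>S. vertex_cutset G S \<and> card S = k) \<and> (\<forall>S. vertex_cutset G S \<longrightarrow> k \<le> card S)"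

text \<open>
  The elements of \<open>K\<close> and of the neighbor set are enumerated increasingly, which fixes the
  order of the columns of \<open>B\<^sub>K\<close> and of the rows of \<open>C\<^sub>j\<close>.
\<close>

definition input_mat :: "nat \<Rightarrow> nat set \<Rightarrow> real mat" where
  "input_mat n K = mat_of_cols n (map (unit_vec n) (sorted_list_of_set K))"

definition output_mat :: "real mat \<Rightarrow> nat \<Rightarrow> real mat" where
  "output_mat A j = mat_of_rows (dim_row A)
     (map (unit_vec (dim_row A)) (sorted_list_of_set (neighbors (communication_graph A) j)))"

primrec state :: "real mat \<Rightarrow> nat set \<Rightarrow> real vec \<Rightarrow> (nat \<Rightarrow> real vec) \<Rightarrow> nat \<Rightarrow> real vec" where
  "state A K x0 u 0 = x0"
| "state A K x0 u (Suc t) = A *\<^sub>v state A K x0 u t + input_mat (dim_row A) K *\<^sub>v u t"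

definition node_output ::
  "real mat \<Rightarrow> nat \<Rightarrow> nat set \<Rightarrow> real vec \<Rightarrow> (nat \<Rightarrow> real vec) \<Rightarrow> nat \<Rightarrow> real vec" where
  "node_output A j K x0 u t = output_mat A j *\<^sub>v state A K x0 u t"

definition inputs :: "nat set \<Rightarrow> (nat \<Rightarrow> real vec) set" where
  "inputs K = {u. \<forall>t. u t \<in> carrier_vec (card K)}"

text \<open>
  Unidentifiability is only defined for inputs of nonempty members of the family; the first
  three conjuncts record this domain.
\<close>

definition unidentifiable ::
  "real mat \<Rightarrow> nat set set \<Rightarrow> nat set \<Rightarrow> (nat \<Rightarrow> real vec) \<Rightarrow> bool" where
  "unidentifiable A \<K> K1 u1 \<longleftrightarrow>
     K1 \<in> \<K> \<and> K1 \<noteq> {} \<and> u1 \<in> inputs K1 \<and>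
     (\<exists>K2\<in>\<K>. K2 \<noteq> K1 \<and>
       (\<exists>u2\<in>inputs K2. \<exists>x1\<in>carrier_vec (dim_row A). \<exists>x2\<in>carrier_vec (dim_row A).
         \<exists>j<dim_row A. \<forall>t. node_output A j K1 x1 u1 t = node_output A j K2 x2 u2 t))"

end

(* Take a minimum vertex cutset S with sides V1, V3 (no arc from V3 to V1). A node j in V1 sees V3
   only through S, so an input acting on S can reproduce, on S and hence on V1, every trajectory
   generated by an input acting outside V1. Exchanging one element of S for one of V3 therefore
   gives a set K of size k all of whose inputs are masked by inputs of S. The exchange needs S to
   be nonempty, which holds because a primitive matrix has a strongly connected graph. *)
theory Submission imports Defs begin

lemma dim_input_mat [simp]: "dim_row (input_mat n K) = n" "dim_col (input_mat n K) = card K"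
  by (simp_all add: input_mat_def)

lemma input_mat_mult_notin:
  assumes "finite K" "w \<in> carrier_vec (card K)" "i < n" "i \<notin> K"
  shows "(input_mat n K *\<^sub>v w) $ i = 0"
proof -
  have "input_mat n K $$ (i, c) = 0" if "c < card K" for c
  proof -
    have "sorted_list_of_set K ! c \<in> K"
      using that assms(1) by (metis length_sorted_list_of_set nth_mem set_sorted_list_of_set)
    with assms that show ?thesis
      by (auto simp: input_mat_def mat_of_cols_def unit_vec_def)
  qed
  then have "row (input_mat n K) i = 0\<^sub>v (card K)"
    using assms(3) by (intro eq_vecI) auto
  with assms show ?thesis by simp
qed

text \<open>The columns of \<open>input_mat n K\<close> are the unit vectors of the elements of
  \<open>K\<close>, so the weights can be read off from \<open>r\<close> in the increasing order of
  \<open>K\<close>.\<close>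

lemma input_mat_surj:
  assumes "K \<subseteq> {0..<n}" "r \<in> carrier_vec n" "\<And>i. i < n \<Longrightarrow> i \<notin> K \<Longrightarrow> r $ i = 0"
  shows "\<exists>w\<in>carrier_vec (card K). input_mat n K *\<^sub>v w = r"
proof -
  define l where "l = sorted_list_of_set K"
  define w where "w = vec (card K) (\<lambda>c. r $ (l ! c))"
  have fin: "finite K" using assms(1) finite_subset by auto
  have l: "set l = K" "distinct l" "length l = card K"
    using fin by (auto simp: l_def)
  have "input_mat n K *\<^sub>v w = r"
  proof (rule eq_vecI)
    fix i assume "i < dim_vec r"
    then have i: "i < n" using assms(2) by simp
    show "(input_mat n K *\<^sub>v w) $ i = r $ i"
    proof (cases "i \<in> K")
      case False
      then show ?thesis
        using assms i input_mat_mult_notin[OF fin, of w i n] by (simp add: w_def)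
    next
      case True
      then obtain c where c: "c < card K" "l ! c = i"
        using l by (metis in_set_conv_nth)
      \<comment> \<open>Since \<open>l\<close> is distinct, \<open>i\<close> occurs only at position
        \<open>c\<close>, so row \<open>i\<close> selects exactly one weight.\<close>
      have entry: "input_mat n K $$ (i, d) = (if d = c then 1 else 0)" if "d < card K" for d
        using that c l i by (auto simp: input_mat_def mat_of_cols_def l_def[symmetric]
            unit_vec_def nth_eq_iff_index_eq)
      have "row (input_mat n K) i = unit_vec (card K) c"
        using entry i c by (intro eq_vecI) auto
      then have "(input_mat n K *\<^sub>v w) $ i = unit_vec (card K) c \<bullet> w"
        using i by simp
      also have "\<dots> = r $ i"
        using c by (simp add: w_def)
      finally show ?thesis .
    qed
  qed (use assms(2) in auto)
  then show ?thesis
    by (intro bexI[of _ w]) (auto simp: w_def)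
qed

lemma state_carrier:
  assumes "A \<in> carrier_mat n n" "x0 \<in> carrier_vec n"
  shows "state A K x0 u t \<in> carrier_vec n"
proof (cases t)
  case 0
  then show ?thesis using assms by simp
next
  case (Suc s)
  have "dim_row A = n" using assms(1) by simp
  then show ?thesis using Suc by (intro carrier_vecI) simp
qed

lemma mult_mat_vec_cong_support:
  fixes A :: "'a :: comm_semiring_0 mat"
  assumes "A \<in> carrier_mat n m" "x \<in> carrier_vec m" "y \<in> carrier_vec m" "i < n"
    and "\<And>c. c < m \<Longrightarrow> A $$ (i, c) \<noteq> 0 \<Longrightarrow> x $ c = y $ c"
  shows "(A *\<^sub>v x) $ i = (A *\<^sub>v y) $ i"
proof -
  have "(\<Sum>c = 0..<m. A $$ (i, c) * x $ c) = (\<Sum>c = 0..<m. A $$ (i, c) * y $ c)"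
    by (intro sum.cong refl) (use assms(5) in force)
  with assms(1-4) show ?thesis
    by (simp add: scalar_prod_def)
qed

text \<open>Each row of \<open>output_mat A j\<close> is the unit vector of a neighbor of
  \<open>j\<close>, so the output merely lists the states of the neighbors.\<close>

lemma node_output_cong:
  assumes A: "A \<in> carrier_mat n n"
    and "state A K1 x1 u1 t \<in> carrier_vec n" "state A K2 x2 u2 t \<in> carrier_vec n"
    and "\<And>i. i \<in> neighbors (communication_graph A) j \<Longrightarrow>
      state A K1 x1 u1 t $ i = state A K2 x2 u2 t $ i"
  shows "node_output A j K1 x1 u1 t = node_output A j K2 x2 u2 t"
proof -
  define N where "N = neighbors (communication_graph A) j"
  define l where "l = sorted_list_of_set N"
  have N: "N \<subseteq> {0..<n}" using A by (auto simp: N_def neighbors_def communication_graph_def)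
  then have "finite N" using finite_subset by auto
  then have l: "set l = N" by (simp add: l_def)
  have C: "output_mat A j = mat_of_rows n (map (unit_vec n) l)"
    using A by (simp add: output_mat_def l_def N_def)
  have "output_mat A j *\<^sub>v state A K1 x1 u1 t = output_mat A j *\<^sub>v state A K2 x2 u2 t"
  proof (rule eq_vecI)
    fix c assume "c < dim_vec (output_mat A j *\<^sub>v state A K2 x2 u2 t)"
    then have c: "c < length l" by (simp add: C)
    then have lc: "l ! c \<in> N" using l by (metis nth_mem)
    have "row (output_mat A j) c = unit_vec n (l ! c)"
      using c by (simp add: C)
    moreover have "l ! c < n" using lc N by auto
    ultimately show "(output_mat A j *\<^sub>v state A K1 x1 u1 t) $ c =
        (output_mat A j *\<^sub>v state A K2 x2 u2 t) $ c"
      using c assms(2-4) lc by (simp add: C N_def)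
  qed (simp add: C)
  then show ?thesis by (simp add: node_output_def)
qed

text \<open>The input required at time \<open>t\<close> is the defect
  \<open>z (Suc t) - A *\<^sub>v z t\<close>. It vanishes off \<open>S\<close>, hence lies in the
  range of \<open>input_mat n S\<close>.\<close>

lemma state_realizes:
  assumes "A \<in> carrier_mat n n" "S \<subseteq> {0..<n}" "\<And>t. z t \<in> carrier_vec n"
    and "\<And>t i. i < n \<Longrightarrow> i \<notin> S \<Longrightarrow> z (Suc t) $ i = (A *\<^sub>v z t) $ i"
  shows "\<exists>u\<in>inputs S. state A S (z 0) u = z"
proof -
  have "\<exists>w\<in>carrier_vec (card S). input_mat n S *\<^sub>v w = z (Suc t) - A *\<^sub>v z t" for t
  proof (rule input_mat_surj[OF assms(2)])
    show "z (Suc t) - A *\<^sub>v z t \<in> carrier_vec n"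
      using assms(1) by (intro carrier_vecI) simp
    have "z (Suc t) $ i - (A *\<^sub>v z t) $ i = 0" if "i < n" "i \<notin> S" for i
      using assms(4)[OF that] by simp
    then show "(z (Suc t) - A *\<^sub>v z t) $ i = 0" if "i < n" "i \<notin> S" for i
      using that assms(1) by simp
  qed
  then obtain u where u: "\<And>t. u t \<in> carrier_vec (card S)"
    "\<And>t. input_mat n S *\<^sub>v u t = z (Suc t) - A *\<^sub>v z t"
    by metis
  have "state A S (z 0) u t = z t" for t
  proof (induction t)
    case (Suc t)
    have "A *\<^sub>v z t + (z (Suc t) - A *\<^sub>v z t) = z (Suc t)"
      using assms(1) assms(3)[of t] assms(3)[of "Suc t"] by (intro eq_vecI) auto
    with Suc assms(1) show ?case by (simp add: u(2))
  qed simp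
  with u(1) show ?thesis by (intro bexI[of _ u]) (auto simp: inputs_def)
qed

text \<open>The set \<open>S\<close> shields \<open>V1\<close>: by \<open>closed\<close>, rows of
  \<open>A\<close> in \<open>V1\<close> read only \<open>V1\<close> and \<open>S\<close>, and
  \<open>K\<close> does not act on \<open>V1\<close> directly. Reproducing the values on
  \<open>S\<close> therefore reproduces them on \<open>V1\<close>.\<close>

lemma masking_input:
  assumes A: "A \<in> carrier_mat n n" and S: "S \<subseteq> {0..<n}"
    and K: "finite K" "K \<inter> V1 = {}"
    and x0: "x0 \<in> carrier_vec n" and u: "u \<in> inputs K"
    and closed: "\<And>i c. i \<in> V1 \<Longrightarrow> c < n \<Longrightarrow> A $$ (i, c) \<noteq> 0 \<Longrightarrow> c \<in> V1 \<union> S"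
  shows "\<exists>u2\<in>inputs S. \<forall>t. \<forall>i<n. i \<in> V1 \<union> S \<longrightarrow>
    state A K x0 u t $ i = state A S x0 u2 t $ i"
proof -
  define x where "x = state A K x0 u"
  have x: "x t \<in> carrier_vec n" for t
    unfolding x_def by (rule state_carrier[OF A x0])
  \<comment> \<open>The masking trajectory \<open>z\<close> copies \<open>x\<close> on
    \<open>S\<close> and evolves freely under \<open>A\<close> elsewhere, so
    \<open>state_realizes\<close> applies to it. On the rest of the nodes it may differ from
    \<open>x\<close>.\<close>
  define F where "F t y = vec n (\<lambda>i. if i \<in> S then x (Suc t) $ i else (A *\<^sub>v y) $ i)" for t y
  define z where "z = rec_nat x0 F"
  have z0: "z 0 = x0" by (simp add: z_def)
  have "z (Suc t) = F t (z t)" for t by (simp add: z_def)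
  then have zS: "z (Suc t) = vec n (\<lambda>i. if i \<in> S then x (Suc t) $ i else (A *\<^sub>v z t) $ i)" for t
    by (simp add: F_def)
  have z: "z t \<in> carrier_vec n" for t
    by (cases t) (simp_all add: z0 zS x0)
  obtain u2 where u2: "u2 \<in> inputs S" "state A S x0 u2 = z"
    using state_realizes[of A n S z, OF A S z] zS z0 by auto
  have "\<forall>i<n. i \<in> V1 \<union> S \<longrightarrow> x t $ i = z t $ i" for t
  proof (induction t)
    case 0
    then show ?case by (simp add: x_def z0)
  next
    case (Suc t)
    show ?case
    proof (intro allI impI)
      fix i assume i: "i < n" "i \<in> V1 \<union> S"
      show "x (Suc t) $ i = z (Suc t) $ i"
      proof (cases "i \<in> S")
        case True
        with i show ?thesis by (simp add: zS)
      next
        case False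
        with i K have iV: "i \<in> V1" "i \<notin> K" by auto
        have "(input_mat n K *\<^sub>v u t) $ i = 0"
          using input_mat_mult_notin[OF K(1) _ i(1) iV(2)] u by (simp add: inputs_def)
        then have "x (Suc t) $ i = (A *\<^sub>v x t) $ i"
          using A i by (simp add: x_def)
        \<comment> \<open>All nonzero entries of row \<open>i\<close> sit in columns of
          \<open>V1 \<union> S\<close>, where the induction hypothesis gives agreement.\<close>
        also have "\<dots> = (A *\<^sub>v z t) $ i"
          using Suc closed[OF iV(1)] by (intro mult_mat_vec_cong_support[OF A x z i(1)]) auto
        also have "\<dots> = z (Suc t) $ i"
          using False i by (simp add: zS)
        finally show ?thesis .
      qed
    qed
  qed
  then show ?thesis
    using u2 by (auto simp: x_def)
qed

text \<open>Block triangular form with respect to \<open>V1\<close> and \<open>V3\<close> is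
  preserved by products.\<close>

lemma pow_mat_block_zero:
  fixes A :: "'a :: semiring_1 mat"
  assumes A: "A \<in> carrier_mat n n" and V: "V1 \<union> V3 = {0..<n}" "V1 \<inter> V3 = {}"
    and zero: "\<And>v u. v \<in> V1 \<Longrightarrow> u \<in> V3 \<Longrightarrow> A $$ (v, u) = 0"
    and "v \<in> V1" "u \<in> V3"
  shows "(A ^\<^sub>m m) $$ (v, u) = 0"
  using assms(5,6)
proof (induction m arbitrary: u)
  case 0
  then have "v < n" "u < n" "v \<noteq> u" using V by auto
  with A show ?case by simp
next
  case (Suc m)
  have lt: "v < n" "u < n" using V Suc.prems by auto
  \<comment> \<open>For \<open>w\<close> in \<open>V1\<close> the second factor is zero by
    hypothesis; for \<open>w\<close> in \<open>V3\<close> the first is zero by induction, which is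
    why \<open>u\<close> is generalized.\<close>
  have "(A ^\<^sub>m m) $$ (v, w) * A $$ (w, u) = 0" if "w < n" for w
  proof -
    from that V(1) have "w \<in> V1 \<or> w \<in> V3" by auto
    with Suc zero show ?thesis by auto
  qed
  then show ?case
    using A lt pow_carrier_mat[OF A, of m] by (simp add: scalar_prod_def)
qed

text \<open>An empty cutset would split all nodes into two blocks and leave a zero entry in every
  power of \<open>A\<close>, whereas some power is entrywise positive.\<close>

lemma primitive_mat_cutset_nonempty:
  assumes "A \<in> carrier_mat n n" "primitive_mat A" "vertex_cutset (communication_graph A) S"
  shows "S \<noteq> {}"
proof
  assume "S = {}"
  with assms(1,3) obtain V1 V3 where V: "V1 \<noteq> {}" "V3 \<noteq> {}" "V1 \<inter> V3 = {}" "V1 \<union> V3 = {0..<n}"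
    and no: "\<forall>u\<in>V3. \<forall>v\<in>V1. (u, v) \<notin> parcs (communication_graph A)"
    by (auto simp: vertex_cutset_def communication_graph_def)
  obtain v u where vu: "v \<in> V1" "u \<in> V3" using V by auto
  have sub: "\<And>x. x \<in> V1 \<union> V3 \<Longrightarrow> x < n" using V(4) by auto
  have "A $$ (b, a) = 0" if "b \<in> V1" "a \<in> V3" for a b
    using no that sub[of a] sub[of b] assms(1) by (auto simp: communication_graph_def)
  then have "(A ^\<^sub>m m) $$ (v, u) = 0" for m
    using pow_mat_block_zero[OF assms(1) V(4,3) _ vu] by blast
  moreover have "v < n" "u < n" using sub vu by auto
  ultimately show False
    using assms(1,2) unfolding primitive_mat_def by (metis carrier_matD less_irrefl)
qed

theorem mainTheorem4:
  fixes A :: "real mat" and n k :: nat and \<K> :: "nat set set"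
  assumes "A \<in> carrier_mat n n"
    and "consensus_matrix A"
    and "has_connectivity (communication_graph A) k"
    and "\<K> \<subseteq> Pow {0..<n}"
    and "{K. K \<subseteq> {0..<n} \<and> card K = k} \<subseteq> \<K>"
  shows "\<exists>K. K \<subseteq> {0..<n} \<and> card K = k \<and> (\<forall>u\<in>inputs K. unidentifiable A \<K> K u)"
proof -
  let ?G = "communication_graph A"
  have n: "dim_row A = n" using assms(1) by simp
  obtain S where cut: "vertex_cutset ?G S" and cardS: "card S = k"
    using assms(3) by (auto simp: has_connectivity_def)
  then obtain V1 V3 where V: "V1 \<noteq> {}" "V3 \<noteq> {}" "V1 \<inter> V3 = {}" "V1 \<union> V3 = {0..<n} - S"
    and no: "\<forall>u\<in>V3. \<forall>v\<in>V1. (u, v) \<notin> parcs ?G" and S: "S \<subseteq> {0..<n}"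
    using n by (auto simp: vertex_cutset_def communication_graph_def)
  have finS: "finite S" using S finite_subset by auto
  obtain s where s: "s \<in> S"
    using primitive_mat_cutset_nonempty[OF assms(1) _ cut] assms(2)
    by (auto simp: consensus_matrix_def)
  obtain j v where j: "j \<in> V1" and v: "v \<in> V3" using V by auto
  have jn: "j < n" and vn: "v < n" "v \<notin> S" using V(4) j v by auto
  \<comment> \<open>Trading \<open>s\<close> for \<open>v\<close> keeps the cardinality
    \<open>k\<close> and avoids \<open>V1\<close>; as \<open>v\<close> is not in \<open>S\<close>,
    the result is nonempty and differs from \<open>S\<close>.\<close>
  define K where "K = insert v (S - {s})"
  have K: "K \<subseteq> {0..<n}" "finite K" "K \<inter> V1 = {}" "K \<noteq> {}" "S \<noteq> K"
    using S vn finS V v by (auto simp: K_def)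
  have cardK: "card K = k"
    using finS s vn cardS card_Suc_Diff1[OF finS s] by (simp add: K_def)
  have "V1 \<union> V3 \<union> S = {0..<n}" using V(4) S by blast
  then have mem: "x \<in> V1 \<or> x \<in> V3 \<or> x \<in> S \<longleftrightarrow> x < n" for x
    by (metis Un_iff atLeastLessThan_iff le0)
  have closed: "c \<in> V1 \<union> S" if "i \<in> V1" "c < n" "A $$ (i, c) \<noteq> 0" for i c
  proof (rule ccontr)
    assume "c \<notin> V1 \<union> S"
    then have "c \<in> V3" using mem[of c] that(2) by simp
    then have "(c, i) \<notin> parcs ?G" using no that(1) by blast
    moreover have "i < n" using mem[of i] that(1) by simp
    ultimately show False using that(2,3) n by (simp add: communication_graph_def)
  qed
  \<comment> \<open>The observer \<open>j\<close> lies in \<open>V1\<close>, so it sees only the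
    region where the two trajectories will coincide.\<close>
  have nb: "i < n \<and> i \<in> V1 \<union> S" if "i \<in> neighbors ?G j" for i
  proof -
    have "i < n" "A $$ (j, i) \<noteq> 0"
      using that n by (simp_all add: neighbors_def communication_graph_def)
    with closed[OF j] show ?thesis by blast
  qed
  have "unidentifiable A \<K> K u" if u: "u \<in> inputs K" for u
  proof -
    \<comment> \<open>Masking works from any common initial state; zero serves as both
      \<open>x1\<close> and \<open>x2\<close>.\<close>
    have zero: "0\<^sub>v n \<in> carrier_vec n" by simp
    obtain u2 where u2: "u2 \<in> inputs S"
      and eq: "\<And>t i. i < n \<Longrightarrow> i \<in> V1 \<union> S \<Longrightarrow>
        state A K (0\<^sub>v n) u t $ i = state A S (0\<^sub>v n) u2 t $ i"
      using masking_input[OF assms(1) S K(2,3) zero u] closed by blast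
    have "node_output A j K (0\<^sub>v n) u t = node_output A j S (0\<^sub>v n) u2 t" for t
      using nb eq by (intro node_output_cong[OF assms(1)] state_carrier[OF assms(1) zero]) blast
    \<comment> \<open>Both sets have cardinality \<open>k\<close>, so the family contains the masked
      set and the masking one.\<close>
    moreover have "K \<in> \<K>" "S \<in> \<K>" using assms(5) K(1) cardK S cardS by auto
    ultimately show ?thesis
      unfolding unidentifiable_def n using K(4,5) u u2 zero jn by blast
  qed
  with K(1) cardK show ?thesis by blast
qed

end
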